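(* Let $G=(V_P\cup V_L,E)$ be a point-hyperplane graph, $\hat p:V_P\to\mathbb{A}^d$ and $\ell=(a,r):V_L\to\mathbb{S}^{d-1}\times\mathbb{R}$. Let $q:V_P\cup V_L\to\mathbb{S}^d_{\ge0}$ be given by $q_i=\hat p_i/\|\hat p_i\|$ for $i\in V_P$ and $q_i=(a_i,0)$ for $i\in V_L$. Let $\gamma$ be a rotation, i.e. $(\gamma\circ q)_i=Rq_i$ for a fixed orthogonal $(d+1)\times(d+1)$ matrix $R$, chosen so that no point $Rq_i$ lies on the equator $\{x\in\mathbb{S}^d:\langle x,\mathbf e\rangle=0\}$; let $\iota$ be the inversion that replaces $Rq_i$ by $-Rq_i$ whenever $\langle Rq_i,\mathbf e\rangle<0$ and leaves the other points unchanged; and let $\phi^{-1}:\{x\in\mathbb{S}^d:\langle x,\mathbf e\rangle>0\}\to\mathbb{A}^d$, $x\mapsto x/\langle x,\mathbf e\rangle$. Let $\hat q=\phi^{-1}\circ\iota\circ\gamma\circ q:V_P\cup V_L\to\mathbb{A}^d$. Then the points $\hat q(V_L)$ all lie on a hyperplane of $\mathbb{A}^d$, and the point-hyperplane framework $(G,\hat p,\ell)$ is infinitesimally rigid if and only if the bar-joint framework $(G,\hat q)$ in $\mathbb{A}^d$ is infinitesimally rigid.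
   Context: Write points of $\mathbb{R}^{d+1}$ as $(x,x')\in\mathbb{R}^d\times\mathbb{R}$; $\mathbf e=(0,\dots,0,1)$, $\mathbb{A}^d=\{x\in\mathbb{R}^{d+1}:\langle x,\mathbf e\rangle=1\}$ (a hyperplane of $\mathbb{A}^d$ means an affine $(d-1)$-dimensional subspace of it), $\mathbb{S}^d$ the unit sphere in $\mathbb{R}^{d+1}$, $\mathbb{S}^d_{\ge0}=\{x\in\mathbb{S}^d:\langle x,\mathbf e\rangle\ge0\}$. A point-hyperplane graph is a graph whose vertex set is partitioned into $V_P$ and $V_L$. An infinitesimal motion of the point-hyperplane framework $(G,\hat p,\ell)$ (with $\ell_j=(a_j,r_j)\in\mathbb{R}^{d+1}$) is a pair $(\dot{\hat p},\dot\ell)$, $\dot{\hat p}_i\in\mathbb{R}^{d+1}$, $\dot\ell_j=(\dot a_j,\dot r_j)\in\mathbb{R}^{d}\times\mathbb{R}$, satisfying $\langle \hat p_i-\hat p_j,\dot{\hat p}_i-\dot{\hat p}_j\rangle=0$ ($ij\in E$, $i,j\in V_P$), $\langle\hat p_i,\dot\ell_j\rangle+\langle\dot{\hat p}_i,\ell_j\rangle=0$ ($ij\in E$, $i\in V_P,j\in V_L$), $\langle a_i,\dot a_j\rangle+\langle\dot a_i,a_j\rangle=0$ ($ij\in E$, $i,j\in V_L$), $\langle\dot{\hat p}_i,\mathbf e\rangle=0$ ($i\in V_P$), $\langle a_i,\dot a_i\rangle=0$ ($i\in V_L$); it is infinitesimally rigid if this space has dimension $\binom{d+1}{2}$. An infinitesimal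 motion of a bar-joint framework $(G,\hat q)$ in $\mathbb{A}^d$ is a map $\dot q:V\to\{m\in\mathbb{R}^{d+1}:\langle m,\mathbf e\rangle=0\}$ with $\langle\hat q_i-\hat q_j,\dot q_i-\dot q_j\rangle=0$ for all $ij\in E$; it is infinitesimally rigid if this space has dimension $\binom{d+1}{2}$ (the paper assumes affine spanning). *)

theory Defs
  imports "HOL-Analysis.Analysis"
begin

text \<open>
  With d = CARD('d), the space of dimension d + 1 is the product of the space of dimension d
  with the real line, carrying the product inner product.
\<close>

type_synonym 'd ambient = "(real ^ 'd) \<times> real"

definition e_vec :: "('d::finite) ambient" where
  "e_vec = (0, 1)"

definition affine_slice :: "('d::finite) ambient set" where
  "affine_slice = {x. x \<bullet> e_vec = 1}"

definition hyperplane_of_slice :: "('d::finite) ambient set \<Rightarrow> bool" where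
  "hyperplane_of_slice H \<longleftrightarrow>
     affine H \<and> H \<subseteq> affine_slice \<and> aff_dim H = int CARD('d) - 1"

text \<open>
  Edges are two-element sets of vertices. Either vertex class may be empty, and the vertex set
  \<open>VP \<union> VL\<close> need not exhaust the finite type \<open>'v\<close>.
\<close>

definition point_hyperplane_graph :: "('v::finite) set \<Rightarrow> 'v set \<Rightarrow> 'v set set \<Rightarrow> bool" where
  "point_hyperplane_graph VP VL E \<longleftrightarrow>
     VP \<inter> VL = {} \<and>
     (\<forall>f\<in>E. \<exists>i\<in>VP \<union> VL. \<exists>j\<in>VP \<union> VL. i \<noteq> j \<and> f = {i, j})"

text \<open>
  A motion assigns velocities to the vertices in \<open>VP\<close> (first component) and in \<open>VL\<close> (second
  component). Such maps are encoded as vectors indexed by \<open>'v\<close> that vanish outside \<open>VP\<close>,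
  respectively \<open>VL\<close>, so that \<open>dim\<close> is the dimension of the space of maps on these sets.
\<close>

definition point_hyperplane_motions ::
  "('v::finite) set \<Rightarrow> 'v set \<Rightarrow> 'v set set \<Rightarrow> ('v \<Rightarrow> ('d::finite) ambient) \<Rightarrow> ('v \<Rightarrow> 'd ambient)
     \<Rightarrow> (('d ambient ^ 'v) \<times> ('d ambient ^ 'v)) set" where
  "point_hyperplane_motions VP VL E p l =
     {(p', l').
        (\<forall>i. i \<notin> VP \<longrightarrow> p' $ i = 0) \<and>
        (\<forall>j. j \<notin> VL \<longrightarrow> l' $ j = 0) \<and>
        (\<forall>i\<in>VP. \<forall>j\<in>VP. {i, j} \<in> E \<longrightarrow> (p i - p j) \<bullet> (p' $ i - p' $ j) = 0) \<and>
        (\<forall>i\<in>VP. \<forall>j\<in>VL. {i, j} \<in> E \<longrightarrow> p i \<bullet> l' $ j + p' $ i \<bullet> l j = 0) \<and>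
        (\<forall>i\<in>VL. \<forall>j\<in>VL. {i, j} \<in> E \<longrightarrow>
            fst (l i) \<bullet> fst (l' $ j) + fst (l' $ i) \<bullet> fst (l j) = 0) \<and>
        (\<forall>i\<in>VP. p' $ i \<bullet> e_vec = 0) \<and>
        (\<forall>i\<in>VL. fst (l i) \<bullet> fst (l' $ i) = 0)}"

definition point_hyperplane_inf_rigid ::
  "('v::finite) set \<Rightarrow> 'v set \<Rightarrow> 'v set set \<Rightarrow> ('v \<Rightarrow> ('d::finite) ambient) \<Rightarrow> ('v \<Rightarrow> 'd ambient)
     \<Rightarrow> bool" where
  "point_hyperplane_inf_rigid VP VL E p l \<longleftrightarrow>
     dim (point_hyperplane_motions VP VL E p l) = (CARD('d) + 1) choose 2"

definition bar_joint_motions ::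
  "('v::finite) set \<Rightarrow> 'v set set \<Rightarrow> ('v \<Rightarrow> ('d::finite) ambient) \<Rightarrow> ('d ambient ^ 'v) set" where
  "bar_joint_motions V E q =
     {q'. (\<forall>i. i \<notin> V \<longrightarrow> q' $ i = 0) \<and>
          (\<forall>i\<in>V. q' $ i \<bullet> e_vec = 0) \<and>
          (\<forall>i\<in>V. \<forall>j\<in>V. {i, j} \<in> E \<longrightarrow> (q i - q j) \<bullet> (q' $ i - q' $ j) = 0)}"

definition bar_joint_inf_rigid ::
  "('v::finite) set \<Rightarrow> 'v set set \<Rightarrow> ('v \<Rightarrow> ('d::finite) ambient) \<Rightarrow> bool" where
  "bar_joint_inf_rigid V E q \<longleftrightarrow>
     dim (bar_joint_motions V E q) = (CARD('d) + 1) choose 2"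

lemma subspace_point_hyperplane_motions: "subspace (point_hyperplane_motions VP VL E p l)"
proof (rule subspaceI)
  show "0 \<in> point_hyperplane_motions VP VL E p l"
    by (simp add: point_hyperplane_motions_def split_beta)
next
  fix x y
  assume "x \<in> point_hyperplane_motions VP VL E p l" "y \<in> point_hyperplane_motions VP VL E p l"
  then show "x + y \<in> point_hyperplane_motions VP VL E p l"
    unfolding point_hyperplane_motions_def
    by (cases x; cases y; clarsimp simp: inner_simps) (smt (verit))
next
  fix c x
  assume "x \<in> point_hyperplane_motions VP VL E p l"
  then show "c *\<^sub>R x \<in> point_hyperplane_motions VP VL E p l"
    unfolding point_hyperplane_motions_def
    by (cases x; clarsimp simp flip: distrib_left scaleR_diff_right)
qed

lemma subspace_bar_joint_motions: "subspace (bar_joint_motions V E q)"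
proof (rule subspaceI)
  show "0 \<in> bar_joint_motions V E q"
    by (simp add: bar_joint_motions_def)
next
  fix x y
  assume "x \<in> bar_joint_motions V E q" "y \<in> bar_joint_motions V E q"
  then show "x + y \<in> bar_joint_motions V E q"
    by (simp add: bar_joint_motions_def inner_left_distrib add_diff_add inner_right_distrib)
next
  fix c x
  assume "x \<in> bar_joint_motions V E q"
  then show "c *\<^sub>R x \<in> bar_joint_motions V E q"
    by (simp add: bar_joint_motions_def flip: scaleR_diff_right)
qed

definition spherical_points ::
  "'v set \<Rightarrow> ('v \<Rightarrow> ('d::finite) ambient) \<Rightarrow> ('v \<Rightarrow> 'd ambient) \<Rightarrow> 'v \<Rightarrow> 'd ambient" where
  "spherical_points VP p l i = (if i \<in> VP then p i /\<^sub>R norm (p i) else (fst (l i), 0))"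

definition flip_up :: "('d::finite) ambient \<Rightarrow> 'd ambient" where
  "flip_up x = (if x \<bullet> e_vec < 0 then - x else x)"

definition central_proj :: "('d::finite) ambient \<Rightarrow> 'd ambient" where
  "central_proj x = x /\<^sub>R (x \<bullet> e_vec)"

end

theory Submission
  imports Defs
begin

text \<open>
  Both notions of motion are infinitesimal motions of one spherical framework. A velocity \<open>m\<close>
  of a point \<open>x\<close> in the affine slice corresponds to the vector \<open>m - (m \<bullet> x) e\<close>, which is
  tangent at \<open>x\<close>; polarising the bar condition turns it into the bilinear condition
  \<open>u\<^sub>i \<bullet> s\<^sub>j + s\<^sub>i \<bullet> u\<^sub>j = 0\<close>. A hyperplane with unit normal \<open>a\<close> is the equatorial point
  \<open>(a, 0)\<close>, and for it the velocity of \<open>(a, r)\<close> already is a tangent vector. The spherical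
  conditions are homogeneous in every \<open>u\<^sub>i\<close> separately and invariant under rotation, so
  normalisation, rotation, inversion and central projection preserve the dimension.
\<close>

section \<open>Spherical motions under scaling and rotation\<close>

text \<open>The equations are the derivatives of \<open>u i \<bullet> u i\<close> and
  \<open>u i \<bullet> u j\<close>. The vectors \<open>u i\<close> may have any length, so points of
  the slice are admissible without normalisation.\<close>

definition spherical_motions ::
  "'v set \<Rightarrow> 'v set set \<Rightarrow> ('v::finite \<Rightarrow> 'a::euclidean_space) \<Rightarrow> ('a ^ 'v) set" where
  "spherical_motions V E u =
     {s. (\<forall>i. i \<notin> V \<longrightarrow> s $ i = 0) \<and>
         (\<forall>i\<in>V. u i \<bullet> s $ i = 0) \<and>
         (\<forall>i\<in>V. \<forall>j\<in>V. {i, j} \<in> E \<longrightarrow> u i \<bullet> s $ j + s $ i \<bullet> u j = 0)}"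

lemma subspace_spherical_motions: "subspace (spherical_motions V E u)"
proof (rule subspaceI)
  show "0 \<in> spherical_motions V E u"
    by (simp add: spherical_motions_def)
next
  fix x y
  assume "x \<in> spherical_motions V E u" "y \<in> spherical_motions V E u"
  then show "x + y \<in> spherical_motions V E u"
    unfolding spherical_motions_def
    by (clarsimp simp: inner_simps) (smt (verit))
next
  fix c x
  assume "x \<in> spherical_motions V E u"
  then show "c *\<^sub>R x \<in> spherical_motions V E u"
    by (simp add: spherical_motions_def flip: distrib_left)
qed

text \<open>Applied once in each direction for every comparison of motion spaces, so that the two
  maps never have to be shown mutually inverse.\<close>

lemma dim_le_linear_image:
  fixes f :: "'a::euclidean_space \<Rightarrow> 'b::euclidean_space"
  assumes "linear f" "subspace S" "\<And>x. x \<in> S \<Longrightarrow> f x \<in> T"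
    and "\<And>x. x \<in> S \<Longrightarrow> f x = 0 \<Longrightarrow> x = 0"
  shows "dim S \<le> dim T"
proof -
  have "inj_on f S"
    using assms by (intro linear_injective_on_subspace_0[THEN iffD2]) auto
  then have "dim (f ` S) = dim S"
    using assms(1,2) by (intro dim_image_eq) (simp_all add: span_eq_iff[THEN iffD2])
  moreover have "dim (f ` S) \<le> dim T"
    using assms(3) by (intro dim_subset) auto
  ultimately show ?thesis by simp
qed

text \<open>Velocities are transformed exactly like the points; an edge equation is then multiplied
  by \<open>c i * c j\<close> and a tangency equation by \<open>c i * c i\<close>.\<close>

lemma dim_spherical_motions_scale_le:
  fixes u w :: "'v::finite \<Rightarrow> 'a::euclidean_space"
  assumes R: "orthogonal_transformation R"
    and c: "\<And>i. i \<in> V \<Longrightarrow> c i \<noteq> 0"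
    and w: "\<And>i. i \<in> V \<Longrightarrow> w i = c i *\<^sub>R R (u i)"
  shows "dim (spherical_motions V E u) \<le> dim (spherical_motions V E w)"
proof (rule dim_le_linear_image[OF _ subspace_spherical_motions])
  have lin: "linear R" and inner_R: "\<And>x y. R x \<bullet> R y = x \<bullet> y"
    using R by (auto simp: orthogonal_transformation_def)
  let ?f = "\<lambda>s. \<chi> i. c i *\<^sub>R R (s $ i)"
  show "linear ?f"
    by (rule linearI) (simp_all add: vec_eq_iff linear_add[OF lin] linear_scale[OF lin] scaleR_add_right)
  fix s :: "'a ^ 'v" assume s: "s \<in> spherical_motions V E u"
  have "c i * (c j * (u i \<bullet> s $ j)) + c i * (c j * (s $ i \<bullet> u j)) = 0"
    if "i \<in> V" "j \<in> V" "{i, j} \<in> E" for i j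
    using s that by (simp add: spherical_motions_def flip: distrib_left)
  then show "?f s \<in> spherical_motions V E w"
    using s by (auto simp: spherical_motions_def w inner_R linear_0[OF lin] algebra_simps)
  assume "?f s = 0"
  then have "norm (R (s $ i)) = 0" if "i \<in> V" for i
    using c[OF that] by (auto simp: vec_eq_iff)
  then show "s = 0"
    using s orthogonal_transformation_norm[OF R] by (auto simp: spherical_motions_def vec_eq_iff)
qed

text \<open>The relation is symmetric: \<open>u\<close> arises from \<open>w\<close> by
  \<open>inv R\<close> and the factors \<open>inverse (c i)\<close>. Negative factors are allowed,
  which covers the inversion.\<close>

lemma dim_spherical_motions_scale:
  fixes u w :: "'v::finite \<Rightarrow> 'a::euclidean_space"
  assumes R: "orthogonal_transformation R"
    and c: "\<And>i. i \<in> V \<Longrightarrow> c i \<noteq> 0"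
    and w: "\<And>i. i \<in> V \<Longrightarrow> w i = c i *\<^sub>R R (u i)"
  shows "dim (spherical_motions V E u) = dim (spherical_motions V E w)"
proof (rule antisym)
  show "dim (spherical_motions V E u) \<le> dim (spherical_motions V E w)"
    using assms by (rule dim_spherical_motions_scale_le)
  have R': "orthogonal_transformation (inv R)"
    using R by (rule orthogonal_transformation_inv)
  then have lin: "linear (inv R)"
    by (rule orthogonal_transformation_linear)
  show "dim (spherical_motions V E w) \<le> dim (spherical_motions V E u)"
  proof (rule dim_spherical_motions_scale_le[OF R'])
    fix i assume "i \<in> V"
    then show "inverse (c i) \<noteq> 0" "u i = inverse (c i) *\<^sub>R inv R (w i)"
      using c w by (simp_all add: linear_scale[OF lin] inv_f_f[OF orthogonal_transformation_inj[OF R]])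
  qed
qed

section \<open>Bar-joint motions as spherical motions\<close>

lemma e_vec_inner_e_vec [simp]: "e_vec \<bullet> e_vec = 1"
  by (simp add: e_vec_def)

text \<open>Since \<open>q i \<bullet> e_vec = 1\<close>, adding a multiple of \<open>e_vec\<close>
  makes a velocity tangent (\<open>?f\<close>) or horizontal (\<open>?g\<close>). Under
  \<open>?f\<close> the spherical edge form equals
  \<open>- ((q i - q j) \<bullet> (m $ i - m $ j))\<close>.\<close>

lemma dim_bar_joint_motions:
  assumes q: "\<And>i. i \<in> V \<Longrightarrow> q i \<in> affine_slice"
  shows "dim (bar_joint_motions V E q) = dim (spherical_motions V E q)"
proof (rule antisym)
  have qe: "q i \<bullet> e_vec = 1" "e_vec \<bullet> q i = 1" if "i \<in> V" for i
    using q[OF that] by (simp_all add: affine_slice_def inner_commute)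
  let ?f = "\<lambda>m. \<chi> i. m $ i - (m $ i \<bullet> q i) *\<^sub>R e_vec"
  let ?g = "\<lambda>s. \<chi> i. s $ i - (s $ i \<bullet> e_vec) *\<^sub>R e_vec"
  show "dim (bar_joint_motions V E q) \<le> dim (spherical_motions V E q)"
  proof (rule dim_le_linear_image[OF _ subspace_bar_joint_motions])
    show "linear ?f"
      by (rule linearI) (simp_all add: vec_eq_iff inner_simps algebra_simps)
    fix m assume m: "m \<in> bar_joint_motions V E q"
    then show "?f m \<in> spherical_motions V E q"
      by (auto simp: bar_joint_motions_def spherical_motions_def inner_simps qe inner_commute
          algebra_simps)
    assume f0: "?f m = 0"
    show "m = 0"
    proof -
      have "m $ i = 0" for i
      proof (cases "i \<in> V")
        case True
        \<comment> \<open>A velocity killed by \<open>?f\<close> is vertical, but those in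
          \<open>m\<close> are horizontal.\<close>
        obtain t where "m $ i = t *\<^sub>R e_vec"
          using f0 by (auto simp: vec_eq_iff)
        moreover have "m $ i \<bullet> e_vec = 0"
          using m True by (simp add: bar_joint_motions_def)
        ultimately show ?thesis
          by simp
      qed (use m in \<open>simp add: bar_joint_motions_def\<close>)
      then show ?thesis by (simp add: vec_eq_iff)
    qed
  qed
  show "dim (spherical_motions V E q) \<le> dim (bar_joint_motions V E q)"
  proof (rule dim_le_linear_image[OF _ subspace_spherical_motions])
    show "linear ?g"
      by (rule linearI) (simp_all add: vec_eq_iff inner_simps algebra_simps)
    fix s assume s: "s \<in> spherical_motions V E q"
    then have tangent: "q i \<bullet> s $ i = 0" "s $ i \<bullet> q i = 0" if "i \<in> V" for i
      using that by (simp_all add: spherical_motions_def inner_commute)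
    show "?g s \<in> bar_joint_motions V E q"
      using s by (auto simp: bar_joint_motions_def spherical_motions_def inner_simps qe tangent
          inner_commute algebra_simps)
    assume g0: "?g s = 0"
    show "s = 0"
    proof -
      have "s $ i = 0" for i
      proof (cases "i \<in> V")
        case True
        \<comment> \<open>A velocity killed by \<open>?g\<close> is vertical; tangency at
          \<open>q i\<close>, which has height 1, forces \<open>t = 0\<close>.\<close>
        obtain t where "s $ i = t *\<^sub>R e_vec"
          using g0 by (auto simp: vec_eq_iff)
        then show ?thesis
          using tangent(2)[OF True] qe[OF True] by simp
      qed (use s in \<open>simp add: spherical_motions_def\<close>)
      then show ?thesis by (simp add: vec_eq_iff)
    qed
  qed
qed

section \<open>Point-hyperplane motions as spherical motions\<close>

text \<open>Points are treated as in the bar-joint case and hyperplane velocities are kept. The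
  offset \<open>snd (l j)\<close> drops out because it is paired only with the zero last coordinate
  of a point velocity.\<close>

lemma dim_point_hyperplane_motions:
  fixes p l :: "'v::finite \<Rightarrow> ('d::finite) ambient"
  assumes disj: "VP \<inter> VL = {}"
    and p: "\<And>i. i \<in> VP \<Longrightarrow> p i \<in> affine_slice"
  shows "dim (point_hyperplane_motions VP VL E p l) =
    dim (spherical_motions (VP \<union> VL) E (\<lambda>i. if i \<in> VP then p i else (fst (l i), 0)))"
    (is "_ = dim (spherical_motions _ _ ?u)")
proof (rule antisym)
  have pe: "snd (p i) = 1" if "i \<in> VP" for i
    using p[OF that] by (simp add: affine_slice_def e_vec_def inner_prod_def)
  let ?f = "\<lambda>(p', l'). \<chi> i. if i \<in> VP then p' $ i - (p' $ i \<bullet> p i) *\<^sub>R e_vec else l' $ i"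
  let ?g = "\<lambda>s. (\<chi> i. if i \<in> VP then s $ i - (s $ i \<bullet> e_vec) *\<^sub>R e_vec else 0,
                 \<chi> i. if i \<in> VL then s $ i else 0)"
  show "dim (point_hyperplane_motions VP VL E p l) \<le> dim (spherical_motions (VP \<union> VL) E ?u)"
  proof (rule dim_le_linear_image[OF _ subspace_point_hyperplane_motions])
    show "linear ?f"
      by (rule linearI) (auto simp: vec_eq_iff inner_simps algebra_simps)
    fix m assume m: "m \<in> point_hyperplane_motions VP VL E p l"
    obtain p' l' where m_eq: "m = (p', l')" by (cases m)
    have off: "\<And>i. i \<notin> VP \<Longrightarrow> p' $ i = 0" "\<And>j. j \<notin> VL \<Longrightarrow> l' $ j = 0"
      and horizontal: "\<And>i. i \<in> VP \<Longrightarrow> snd (p' $ i) = 0"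
      and unit: "\<And>i. i \<in> VL \<Longrightarrow> fst (l i) \<bullet> fst (l' $ i) = 0"
      and PP: "\<And>i j. i \<in> VP \<Longrightarrow> j \<in> VP \<Longrightarrow> {i, j} \<in> E \<Longrightarrow> (p i - p j) \<bullet> (p' $ i - p' $ j) = 0"
      and PL: "\<And>i j. i \<in> VP \<Longrightarrow> j \<in> VL \<Longrightarrow> {i, j} \<in> E \<Longrightarrow> p i \<bullet> l' $ j + p' $ i \<bullet> l j = 0"
      and LL: "\<And>i j. i \<in> VL \<Longrightarrow> j \<in> VL \<Longrightarrow> {i, j} \<in> E \<Longrightarrow>
                 fst (l i) \<bullet> fst (l' $ j) + fst (l' $ i) \<bullet> fst (l j) = 0"
      using m unfolding m_eq point_hyperplane_motions_def
      by (auto simp: e_vec_def inner_prod_def)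
    have edge: "?u i \<bullet> ?f m $ j + ?f m $ i \<bullet> ?u j = 0"
      if ij: "i \<in> VP \<union> VL" "j \<in> VP \<union> VL" and E: "{i, j} \<in> E" for i j
    proof -
      \<comment> \<open>Edges are unordered, while the incidence condition names the point first;
        the third case uses it with \<open>i\<close> and \<open>j\<close> exchanged.\<close>
      consider "i \<in> VP" "j \<in> VP" | "i \<in> VP" "j \<in> VL" "j \<notin> VP" | "i \<in> VL" "i \<notin> VP" "j \<in> VP"
        | "i \<in> VL" "i \<notin> VP" "j \<in> VL" "j \<notin> VP"
        using ij by blast
      then show ?thesis
      proof cases
        case 1
        then show ?thesis
          using PP[OF 1 E]
          by (simp add: m_eq inner_prod_def e_vec_def pe horizontal inner_simps inner_commute algebra_simps)
      next
        case 2
        then show ?thesis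
          using PL[OF 2(1,2) E]
          by (simp add: m_eq inner_prod_def e_vec_def pe horizontal inner_simps inner_commute algebra_simps)
      next
        case 3
        then show ?thesis
          using PL[OF 3(3,1)] E
          by (simp add: m_eq inner_prod_def e_vec_def pe horizontal inner_simps inner_commute insert_commute algebra_simps)
      next
        case 4
        then show ?thesis
          using LL[OF 4(1,3) E] by (simp add: m_eq inner_prod_def)
      qed
    qed
    have "?u i \<bullet> ?f m $ i = 0" if "i \<in> VP \<union> VL" for i
      using that unit[of i] by (auto simp: m_eq inner_prod_def e_vec_def pe horizontal inner_simps inner_commute)
    with edge off show "?f m \<in> spherical_motions (VP \<union> VL) E ?u"
      by (simp add: spherical_motions_def m_eq)
    assume f0: "?f m = 0"
    show "m = 0"
    proof -
      have "p' $ i = 0" for i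
      proof (cases "i \<in> VP")
        case True
        have "?f m $ i = 0"
          using f0 by simp
        then obtain t where "p' $ i = t *\<^sub>R e_vec"
          using True by (auto simp: m_eq)
        then show ?thesis
          using horizontal[OF True] by (simp add: e_vec_def prod_eq_iff)
      qed (simp add: off)
      moreover have "l' $ i = 0" for i
      proof (cases "i \<in> VL")
        case True
        \<comment> \<open>Disjointness ensures that \<open>?f\<close> shows \<open>l' $ i\<close>
          here, not a point velocity.\<close>
        then have "i \<notin> VP" using disj by blast
        moreover have "?f m $ i = 0"
          using f0 by simp
        ultimately show ?thesis
          by (simp add: m_eq)
      qed (simp add: off)
      ultimately show ?thesis by (simp add: m_eq vec_eq_iff zero_prod_def)
    qed
  qed
  show "dim (spherical_motions (VP \<union> VL) E ?u) \<le> dim (point_hyperplane_motions VP VL E p l)"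
  proof (rule dim_le_linear_image[OF _ subspace_spherical_motions])
    show "linear ?g"
      by (rule linearI) (auto simp: vec_eq_iff inner_simps algebra_simps)
    fix s assume s: "s \<in> spherical_motions (VP \<union> VL) E ?u"
    have off: "\<And>i. i \<notin> VP \<union> VL \<Longrightarrow> s $ i = 0"
      and tangent: "\<And>i. i \<in> VP \<union> VL \<Longrightarrow> ?u i \<bullet> s $ i = 0"
      and edge: "\<And>i j. i \<in> VP \<union> VL \<Longrightarrow> j \<in> VP \<union> VL \<Longrightarrow> {i, j} \<in> E \<Longrightarrow>
                   ?u i \<bullet> s $ j + s $ i \<bullet> ?u j = 0"
      using s unfolding spherical_motions_def by blast+
    \<comment> \<open>At height 1, tangency determines the last coordinate from the others, so
      \<open>?g\<close> loses no information by erasing it.\<close>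
    have tangentP: "fst (p i) \<bullet> fst (s $ i) = - snd (s $ i)" if "i \<in> VP" for i
      using tangent[of i] that by (simp add: inner_prod_def pe)
    have nP: "i \<notin> VP" if "i \<in> VL" for i
      using that disj by blast
    have nL: "i \<notin> VL" if "i \<in> VP" for i
      using that disj by blast
    \<comment> \<open>\<open>tangentP\<close> turns the two diagonal terms of the expansion into
      last coordinates; the result is the negated edge equation.\<close>
    have PP: "(p i - p j) \<bullet> (fst (?g s) $ i - fst (?g s) $ j) = 0"
      if "i \<in> VP" "j \<in> VP" "{i, j} \<in> E" for i j
      using edge[of i j] that tangentP[of i] tangentP[of j]
      by (simp add: inner_prod_def e_vec_def pe inner_simps inner_commute algebra_simps)
    have PL: "p i \<bullet> snd (?g s) $ j + fst (?g s) $ i \<bullet> l j = 0"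
      if "i \<in> VP" "j \<in> VL" "{i, j} \<in> E" for i j
      using edge[of i j] that nP[of j]
      by (simp add: inner_prod_def e_vec_def pe inner_simps)
    have LL: "fst (l i) \<bullet> fst (snd (?g s) $ j) + fst (snd (?g s) $ i) \<bullet> fst (l j) = 0"
      if "i \<in> VL" "j \<in> VL" "{i, j} \<in> E" for i j
      using edge[of i j] that nP[of i] nP[of j] by (simp add: inner_prod_def)
    have "fst (l i) \<bullet> fst (snd (?g s) $ i) = 0" if "i \<in> VL" for i
      using tangent[of i] that nP[of i] by (simp add: inner_prod_def)
    moreover have "(s $ i - (s $ i \<bullet> e_vec) *\<^sub>R e_vec) \<bullet> e_vec = 0" for i
      by (simp add: inner_simps)
    ultimately show "?g s \<in> point_hyperplane_motions VP VL E p l"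
      using PP PL LL unfolding point_hyperplane_motions_def by simp
    assume g0: "?g s = 0"
    show "s = 0"
    proof -
      have "s $ i = 0" for i
      proof -
        have gi: "fst (?g s) $ i = 0" "snd (?g s) $ i = 0"
          using g0 by (simp_all add: zero_prod_def)
        consider "i \<in> VP" | "i \<in> VL" | "i \<notin> VP \<union> VL" by blast
        then show ?thesis
        proof cases
          case 1
          then obtain t where "s $ i = t *\<^sub>R e_vec"
            using gi(1) by auto
          then have "fst (s $ i) = 0"
            by (simp add: e_vec_def)
          then show ?thesis
            using tangentP[OF 1] by (simp add: prod_eq_iff)
        next
          case 2
          then show ?thesis
            using gi(2) by simp
        qed (rule off)
      qed
      then show ?thesis by (simp add: vec_eq_iff)
    qed
  qed
qed

section \<open>Hyperplanes of the slice\<close>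

text \<open>A linear hyperplane that meets the slice without containing it lowers its dimension by
  exactly one; a normal that is not vertical ensures both.\<close>

lemma hyperplane_of_slice_Int:
  fixes n :: "('d::finite) ambient"
  assumes n: "fst n \<noteq> 0"
  shows "hyperplane_of_slice (affine_slice \<inter> {x. n \<bullet> x = 0})"
proof -
  have slice: "(affine_slice :: 'd ambient set) = {x. e_vec \<bullet> x = 1}"
    by (simp add: affine_slice_def inner_commute)
  have aff: "affine (affine_slice :: 'd ambient set)"
    by (simp add: slice affine_hyperplane)
  have e0: "(e_vec :: 'd ambient) \<noteq> 0"
    by (simp add: e_vec_def zero_prod_def)
  have dim_slice: "aff_dim (affine_slice :: 'd ambient set) = int CARD('d)"
    using aff_dim_hyperplane[OF e0, of 1] by (simp add: slice)
  \<comment> \<open>The multiple of \<open>fst n\<close> is solved from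
    \<open>n \<bullet> ?x t = t\<close>; \<open>t = 0\<close> gives a point on the hyperplane and
    \<open>t = 1\<close> one off it.\<close>
  let ?x = "\<lambda>t. (((t - snd n) / (fst n \<bullet> fst n)) *\<^sub>R fst n, 1) :: 'd ambient"
  have mem: "?x t \<in> affine_slice" "n \<bullet> ?x t = t" for t
    using n by (simp_all add: affine_slice_def e_vec_def inner_prod_def)
  have "?x 0 \<in> affine_slice \<inter> {x. n \<bullet> x = 0}" "?x 1 \<in> affine_slice - {x. n \<bullet> x = 0}"
    using mem[of 0] mem[of 1] by simp_all
  then have "aff_dim (affine_slice \<inter> {x. n \<bullet> x = 0}) = int CARD('d) - 1"
    using aff_dim_affine_Int_hyperplane[OF aff, of n 0] dim_slice by auto
  then show ?thesis
    unfolding hyperplane_of_slice_def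
    using aff by (auto intro: affine_Int affine_hyperplane)
qed

theorem theorem2p3:
  fixes VP VL :: "('v::finite) set" and E :: "'v set set"
    and p l :: "'v \<Rightarrow> ('d::finite) ambient"
    and R :: "'d ambient \<Rightarrow> 'd ambient"
    and q qhat :: "'v \<Rightarrow> 'd ambient"
  assumes "point_hyperplane_graph VP VL E"
    and "\<And>i. i \<in> VP \<Longrightarrow> p i \<in> affine_slice"
    and "\<And>j. j \<in> VL \<Longrightarrow> l j \<in> sphere 0 1 \<times> UNIV"
    and "q = spherical_points VP p l"
    and "orthogonal_transformation R"
    and "\<And>i. i \<in> VP \<union> VL \<Longrightarrow> R (q i) \<bullet> e_vec \<noteq> 0"
    and "qhat = central_proj \<circ> flip_up \<circ> R \<circ> q"
  shows "(\<exists>H. hyperplane_of_slice H \<and> qhat ` VL \<subseteq> H) \<and>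
    (point_hyperplane_inf_rigid VP VL E p l \<longleftrightarrow> bar_joint_inf_rigid (VP \<union> VL) E qhat)"
proof
  have disj: "VP \<inter> VL = {}"
    using assms(1) by (simp add: point_hyperplane_graph_def)
  have lin: "linear R" and inner_R: "\<And>x y. R x \<bullet> R y = x \<bullet> y"
    using assms(5) by (auto simp: orthogonal_transformation_def)
  \<comment> \<open>A sign change also negates the height, so division by the height cancels the
    inversion.\<close>
  have qhat: "qhat i = inverse (R (q i) \<bullet> e_vec) *\<^sub>R R (q i)" for i
    by (simp add: assms(7) central_proj_def flip_up_def)
  have qhat_slice: "qhat i \<in> affine_slice" if "i \<in> VP \<union> VL" for i
    using assms(6)[OF that] by (simp add: qhat affine_slice_def)
  have qL: "q j = (fst (l j), 0)" if "j \<in> VL" for j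
    using that disj by (auto simp: assms(4) spherical_points_def)
  \<comment> \<open>Hyperplane vertices start on the equator, which \<open>R\<close> carries to the
    orthogonal complement of \<open>R e_vec\<close>.\<close>
  have perp: "R e_vec \<bullet> R (q j) = 0" if "j \<in> VL" for j
    by (simp add: inner_R qL[OF that] e_vec_def)

  show "\<exists>H. hyperplane_of_slice H \<and> qhat ` VL \<subseteq> H"
  proof (cases "VL = {}")
    case True
    \<comment> \<open>Without hyperplane vertices \<open>R e_vec\<close> may be vertical, so an
      arbitrary horizontal normal is taken.\<close>
    have "fst (axis undefined 1, 0) \<noteq> (0 :: real ^ 'd)"
      by (simp add: axis_eq_0_iff)
    then show ?thesis
      using hyperplane_of_slice_Int True by blast
  next
    case False
    then obtain j where j: "j \<in> VL" by blast
    \<comment> \<open>If \<open>R e_vec\<close> were vertical, \<open>R\<close> would map the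
      equator to itself and \<open>R (q j)\<close> would lie on it.\<close>
    have "fst (R e_vec) \<noteq> 0"
    proof
      assume fst0: "fst (R e_vec) = 0"
      have "R e_vec \<noteq> 0"
        using inner_R[of e_vec e_vec] by auto
      then have "snd (R e_vec) \<noteq> 0"
        using fst0 by (simp add: prod_eq_iff)
      then have "snd (R (q j)) = 0"
        using perp[OF j] fst0 by (simp add: inner_prod_def)
      then show False
        using assms(6)[of j] j by (simp add: e_vec_def inner_prod_def)
    qed
    from hyperplane_of_slice_Int[OF this] show ?thesis
      using qhat_slice perp by (intro exI conjI) (auto simp: qhat)
  qed

  let ?u = "\<lambda>i. if i \<in> VP then p i else (fst (l i), 0)"
  \<comment> \<open>One factor collects the normalisation of the points, the inversion sign and the
    central projection.\<close>
  define c where "c i = inverse (R (q i) \<bullet> e_vec) * (if i \<in> VP then inverse (norm (p i)) else 1)" for i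
  have p0: "p i \<noteq> 0" if "i \<in> VP" for i
    using assms(2)[OF that] by (auto simp: affine_slice_def)
  have "dim (point_hyperplane_motions VP VL E p l) = dim (spherical_motions (VP \<union> VL) E ?u)"
    using disj assms(2) by (rule dim_point_hyperplane_motions)
  also have "\<dots> = dim (spherical_motions (VP \<union> VL) E qhat)"
  proof (rule dim_spherical_motions_scale[OF assms(5)])
    fix i assume i: "i \<in> VP \<union> VL"
    show "c i \<noteq> 0"
      using assms(6)[OF i] p0 by (simp add: c_def)
    have "R (q i) = (if i \<in> VP then inverse (norm (p i)) else 1) *\<^sub>R R (?u i)"
      by (simp add: assms(4) spherical_points_def linear_scale[OF lin])
    then have "qhat i = inverse (R (q i) \<bullet> e_vec) *\<^sub>R
        (if i \<in> VP then inverse (norm (p i)) else 1) *\<^sub>R R (?u i)"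
      using qhat[of i] by simp
    then show "qhat i = c i *\<^sub>R R (?u i)"
      unfolding c_def scaleR_scaleR .
  qed
  also have "\<dots> = dim (bar_joint_motions (VP \<union> VL) E qhat)"
    using qhat_slice by (rule dim_bar_joint_motions[symmetric])
  finally show "point_hyperplane_inf_rigid VP VL E p l \<longleftrightarrow> bar_joint_inf_rigid (VP \<union> VL) E qhat"
    by (simp add: point_hyperplane_inf_rigid_def bar_joint_inf_rigid_def)
qed

end
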